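(* Each of the permutations $215463$, $236145$ and $214653$ is an annihilator: for each $\phi\in\{215463,236145,214653\}$, every permutation $\pi$ that has an interval copy of $\phi$ satisfies $\mu[1,\pi]=0$.
   Context: Permutations are ordered by containment: $\sigma\le\pi$ if $\pi$ has a subsequence order-isomorphic to $\sigma$. The Möbius function: $\mu[\sigma,\pi]=0$ if $\sigma\not\le\pi$, $\mu[\sigma,\pi]=1$ if $\sigma=\pi$, and $\mu[\sigma,\pi]=-\sum_{\sigma\le\tau<\pi}\mu[\sigma,\tau]$ otherwise; $1$ is the permutation of length one. An interval of a permutation is a non-empty set of contiguous positions whose values form a set of consecutive integers; $\pi$ has an interval copy of $\phi$ if it has an interval of length $|\phi|$ whose entries are order-isomorphic to $\phi$. *)

theory Defs
  imports Complex_Main "HOL-Library.Sublist"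
begin

text \<open>
  Permutations are in one-line notation: the entry at (0-based) list index \<open>i\<close> is the value
  \<open>\<pi>(i + 1)\<close>. The empty list satisfies the predicate; it lies below every permutation and therefore
  in no interval \<open>[\<sigma>, \<pi>]\<close> with \<open>\<sigma>\<close> non-empty.
\<close>

definition is_perm :: "nat list \<Rightarrow> bool" where
  "is_perm p \<longleftrightarrow> distinct p \<and> set p = {1..length p}"

definition order_iso :: "nat list \<Rightarrow> nat list \<Rightarrow> bool" where
  "order_iso xs ys \<longleftrightarrow> length xs = length ys \<and>
     (\<forall>i<length xs. \<forall>j<length xs. xs ! i < xs ! j \<longleftrightarrow> ys ! i < ys ! j)"

definition contained_in :: "nat list \<Rightarrow> nat list \<Rightarrow> bool" where
  "contained_in \<sigma> \<pi> \<longleftrightarrow> (\<exists>s. subseq s \<pi> \<and> order_iso s \<sigma>)"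

lemma contained_in_length: "contained_in \<sigma> \<pi> \<Longrightarrow> length \<sigma> \<le> length \<pi>"
  unfolding contained_in_def order_iso_def by (metis list_emb_length)

lemma is_perm_rank:
  assumes "is_perm p" "i < length p"
  shows "p ! i = Suc (card {j. j < length p \<and> p ! j < p ! i})"
proof -
  have inj: "inj_on ((!) p) {j. j < length p \<and> p ! j < p ! i}"
    using assms(1) by (auto simp: inj_on_def is_perm_def nth_eq_iff_index_eq)
  have sp: "set p = {1..length p}" using assms(1) by (simp add: is_perm_def)
  have "p ! i \<in> {1..length p}" using assms(2) sp by (metis nth_mem)
  then have "(!) p ` {j. j < length p \<and> p ! j < p ! i} = {v \<in> set p. v < p ! i}"
    by (auto simp: in_set_conv_nth)
  also have "\<dots> = {1..<p ! i}"
    using sp \<open>p ! i \<in> {1..length p}\<close> by auto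
  finally have "card {j. j < length p \<and> p ! j < p ! i} = p ! i - 1"
    using card_image[OF inj] by simp
  then show ?thesis using \<open>p ! i \<in> {1..length p}\<close> by simp
qed

lemma is_perm_order_iso_eq:
  assumes "is_perm p" "is_perm q" "order_iso p q"
  shows "p = q"
proof (rule nth_equalityI)
  show len: "length p = length q" using assms(3) by (simp add: order_iso_def)
  fix i assume i: "i < length p"
  have "{j. j < length p \<and> p ! j < p ! i} = {j. j < length q \<and> q ! j < q ! i}"
    using assms(3) i by (auto simp: order_iso_def)
  then show "p ! i = q ! i"
    using is_perm_rank[OF assms(1) i] is_perm_rank[OF assms(2), of i] i len by simp
qed

lemma contained_in_length_less:
  assumes "is_perm \<tau>" "is_perm \<pi>" "contained_in \<tau> \<pi>" "\<tau> \<noteq> \<pi>"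
  shows "length \<tau> < length \<pi>"
proof (rule ccontr)
  assume "\<not> length \<tau> < length \<pi>"
  then have len: "length \<tau> = length \<pi>" using contained_in_length[OF assms(3)] by simp
  obtain s where s: "subseq s \<pi>" "order_iso s \<tau>"
    using assms(3) by (auto simp: contained_in_def)
  then have "s = \<pi>" using len by (metis order_iso_def subseq_same_length)
  then show False using s assms is_perm_order_iso_eq by metis
qed

text \<open>The case of arguments that are not permutations is junk, put to 0.\<close>

function mobius :: "nat list \<Rightarrow> nat list \<Rightarrow> int" where
  "mobius \<sigma> \<pi> =
     (if \<not> is_perm \<sigma> \<or> \<not> is_perm \<pi> \<or> \<not> contained_in \<sigma> \<pi> then 0
      else if \<sigma> = \<pi> then 1
      else - (\<Sum>\<tau>\<in>{\<tau>. is_perm \<tau> \<and> contained_in \<sigma> \<tau> \<and> contained_in \<tau> \<pi> \<and> \<tau> \<noteq> \<pi>}. mobius \<sigma> \<tau>))"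
  by pat_completeness auto
termination
  by (relation "measure (\<lambda>(\<sigma>, \<pi>). length \<pi>)") (auto intro: contained_in_length_less)

declare mobius.simps [simp del]

text \<open>The sum above is over a finite set, so it is not subject to the convention for infinite sums.\<close>

lemma finite_contained_in: "finite {\<tau>. is_perm \<tau> \<and> contained_in \<tau> \<pi>}"
proof (rule finite_subset)
  show "{\<tau>. is_perm \<tau> \<and> contained_in \<tau> \<pi>} \<subseteq> {\<tau>. set \<tau> \<subseteq> {..length \<pi>} \<and> length \<tau> \<le> length \<pi>}"
    using contained_in_length by (force simp: is_perm_def)
  show "finite {\<tau>. set \<tau> \<subseteq> {..length \<pi>} \<and> length \<tau> \<le> length \<pi>}"
    by (rule finite_lists_length_le) simp
qed

text \<open>
  An interval is represented by its contiguous block of entries; as the entries of a permutation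
  are distinct, the block determines its set of positions.
\<close>

definition is_interval_of :: "nat list \<Rightarrow> nat list \<Rightarrow> bool" where
  "is_interval_of xs \<pi> \<longleftrightarrow> xs \<noteq> [] \<and> sublist xs \<pi> \<and> (\<exists>m n. set xs = {m..n})"

definition has_interval_copy :: "nat list \<Rightarrow> nat list \<Rightarrow> bool" where
  "has_interval_copy \<pi> \<phi> \<longleftrightarrow> (\<exists>xs. is_interval_of xs \<pi> \<and> length xs = length \<phi> \<and> order_iso xs \<phi>)"

definition annihilator :: "nat list \<Rightarrow> bool" where
  "annihilator \<phi> \<longleftrightarrow> (\<forall>\<pi>. is_perm \<pi> \<longrightarrow> has_interval_copy \<pi> \<phi> \<longrightarrow> mobius [1] \<pi> = 0)"

end

theory Submission
  imports Defs
begin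

text \<open>
  Let \<open>\<pi>\<close> contain disjoint interval copies of \<open>P\<close> and \<open>Q\<close>, and for subpatterns \<open>x\<close> of \<open>P\<close> and \<open>y\<close> of \<open>Q\<close> let
  \<open>A x y\<close> be \<open>\<pi>\<close> with these copies shrunk to \<open>x\<close> and \<open>y\<close>. As \<open>\<mu>[1,\<cdot>]\<close> sums to zero below every \<open>A x y\<close>
  of length at least two, \<open>\<mu>[1,\<pi>] = 0\<close> follows once there are integer weights \<open>w x y\<close> such that every
  \<open>\<tau> < \<pi>\<close> with \<open>\<mu>[1,\<tau>] \<noteq> 0\<close> satisfies \<open>(\<Sum> {w x y | \<tau> \<le> A x y}) = 1\<close>. Now \<open>\<tau> \<le> A x y\<close> holds iff some embedding
  of \<open>\<tau>\<close> into \<open>\<pi>\<close> meets the two copies in patterns \<open>(t, u) \<le> (x, y)\<close>, and then \<open>\<tau>\<close> itself has interval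
  copies of \<open>t\<close> and \<open>u\<close>. So the weights need only be tested on sets of pairs \<open>(t, u)\<close> whose interval copies
  are not jointly known to force \<open>\<mu>[1,\<tau>] = 0\<close>, which is a finite computation. By induction on the
  length, a joint occurrence of \<open>P\<close> and \<open>Q\<close> in \<open>\<tau>\<close> is already known to force it. Starting from the pair
  \<open>12\<close>, \<open>21\<close> (opposing adjacencies) and from the single patterns \<open>123\<close> and \<open>321\<close>, thirteen such steps lead to
  the three permutations.
\<close>

section \<open>Order isomorphism and standardization\<close>

definition std :: "nat list \<Rightarrow> nat list" where
  "std s = map (\<lambda>v. length (filter (\<lambda>u. u \<le> v) s)) s"

lemma length_std [simp]: "length (std s) = length s"
  by (simp add: std_def)

lemma order_iso_mapI:
  assumes "strict_mono_on (set xs) f"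
  shows "order_iso xs (map f xs)"
  using assms by (auto simp: order_iso_def strict_mono_on_less)

lemma order_iso_mapE:
  assumes "order_iso xs ys"
  obtains f where "strict_mono_on (set xs) f" "ys = map f xs"
proof -
  \<comment> \<open>\<open>g v\<close> is some position of \<open>v\<close> in \<open>xs\<close>.
    With repeated entries the choice is immaterial, since equal entries of \<open>xs\<close> face
    equal entries of \<open>ys\<close>.\<close>
  define g where "g v = (SOME i. i < length xs \<and> xs ! i = v)" for v
  have g: "g v < length xs \<and> xs ! g v = v" if "v \<in> set xs" for v
    unfolding g_def by (rule someI_ex) (use that in \<open>auto simp: in_set_conv_nth\<close>)
  have len: "length xs = length ys"
    and iso: "\<And>i j. i < length xs \<Longrightarrow> j < length xs \<Longrightarrow> xs ! i < xs ! j \<longleftrightarrow> ys ! i < ys ! j"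
    using assms by (auto simp: order_iso_def)
  have "strict_mono_on (set xs) (\<lambda>v. ys ! g v)"
  proof (rule strict_mono_onI)
    fix u v assume "u \<in> set xs" "v \<in> set xs" "u < v"
    then show "ys ! g u < ys ! g v" using iso[of "g u" "g v"] g[of u] g[of v] by simp
  qed
  moreover have "ys = map (\<lambda>v. ys ! g v) xs"
  proof (rule nth_equalityI)
    fix i assume "i < length ys"
    then have i: "i < length xs" and x: "xs ! i \<in> set xs" using len by simp_all
    have "\<not> ys ! i < ys ! g (xs ! i)" "\<not> ys ! g (xs ! i) < ys ! i"
      using iso[of i "g (xs ! i)"] iso[of "g (xs ! i)" i] g[OF x] i by simp_all
    then show "ys ! i = map (\<lambda>v. ys ! g v) xs ! i" using i by simp
  qed (simp add: len)
  ultimately show ?thesis by (rule that)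
qed

lemma order_iso_refl [simp]: "order_iso xs xs"
  by (simp add: order_iso_def)

lemma order_iso_sym: "order_iso xs ys \<Longrightarrow> order_iso ys xs"
  by (auto simp: order_iso_def)

lemma order_iso_trans: "order_iso xs ys \<Longrightarrow> order_iso ys zs \<Longrightarrow> order_iso xs zs"
  by (auto simp: order_iso_def)

lemma order_iso_length: "order_iso xs ys \<Longrightarrow> length xs = length ys"
  by (simp add: order_iso_def)

lemma order_iso_distinct:
  assumes "order_iso xs ys" "distinct xs"
  shows "distinct ys"
proof -
  obtain f where f: "strict_mono_on (set xs) f" "ys = map f xs" using assms(1) by (rule order_iso_mapE)
  then show ?thesis using assms(2) by (simp add: distinct_map strict_mono_on_imp_inj_on)
qed

lemma order_iso_std: "order_iso s (std s)"
  unfolding std_def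
proof (rule order_iso_mapI, rule strict_mono_onI)
  fix u v assume uv: "u \<in> set s" "v \<in> set s" "u < v"
  have "filter (\<lambda>x. x \<le> u) (filter (\<lambda>x. x \<le> v) s) = filter (\<lambda>x. x \<le> u) s"
    unfolding filter_filter by (rule filter_cong) (use uv in auto)
  moreover have "v \<in> set (filter (\<lambda>x. x \<le> v) s)" "\<not> v \<le> u" using uv by auto
  ultimately show "length (filter (\<lambda>x. x \<le> u) s) < length (filter (\<lambda>x. x \<le> v) s)"
    using length_filter_less[of v "filter (\<lambda>x. x \<le> v) s" "\<lambda>x. x \<le> u"] by simp
qed

lemma order_iso_iff_std: "order_iso xs ys \<longleftrightarrow> std xs = std ys"
proof
  assume "order_iso xs ys"
  then obtain f where f: "strict_mono_on (set xs) f" "ys = map f xs" by (rule order_iso_mapE)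
  have "length (filter (\<lambda>u. u \<le> v) xs) = length (filter (\<lambda>u. u \<le> f v) (map f xs))"
    if "v \<in> set xs" for v
    using f(1) that by (auto simp: filter_map o_def strict_mono_on_less_eq intro!: arg_cong[of _ _ length] filter_cong)
  then show "std xs = std ys" by (simp add: std_def f(2))
next
  assume "std xs = std ys"
  then show "order_iso xs ys" by (metis order_iso_std order_iso_sym order_iso_trans)
qed

lemma std_std [simp]: "std (std s) = std s"
  using order_iso_iff_std order_iso_std by metis

lemma is_perm_std:
  assumes "distinct s"
  shows "is_perm (std s)"
proof -
  have d: "distinct (std s)" using assms order_iso_distinct order_iso_std by blast
  have "set (std s) \<subseteq> {1..length s}"
  proof
    fix w assume "w \<in> set (std s)"
    then obtain v where v: "v \<in> set s" "w = length (filter (\<lambda>u. u \<le> v) s)"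
      by (auto simp: std_def)
    then have "v \<in> set (filter (\<lambda>u. u \<le> v) s)" by simp
    then have "length (filter (\<lambda>u. u \<le> v) s) \<noteq> 0" by (metis length_0_conv empty_iff empty_set)
    with v show "w \<in> {1..length s}" by (auto simp: Suc_le_eq)
  qed
  moreover have "card (set (std s)) = card {1..length s}" using d by (simp add: distinct_card)
  ultimately have "set (std s) = {1..length s}" by (intro card_subset_eq) auto
  with d show ?thesis by (simp add: is_perm_def)
qed

lemma std_perm: "is_perm p \<Longrightarrow> std p = p"
  using is_perm_order_iso_eq[of p "std p"] is_perm_std[of p] order_iso_std by (simp add: is_perm_def)

section \<open>Subsequences and pattern containment for arbitrary lists\<close>

lemma subseq_set: "subseq xs ys \<Longrightarrow> set xs \<subseteq> set ys"
  by (auto elim: list_emb_set)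

lemma subseq_mapE:
  assumes "subseq zs (map f xs)"
  obtains ws where "subseq ws xs" "zs = map f ws"
proof -
  have "\<exists>ws. subseq ws xs \<and> zs = map f ws"
    using assms
  proof (induction xs arbitrary: zs)
    case (Cons x xs)
    from Cons.prems show ?case
    proof (cases rule: list_emb.cases)
      case (list_emb_Cons ys)
      with Cons.IH obtain ws where "subseq ws xs" "zs = map f ws" by force
      then show ?thesis by (intro exI[of _ ws]) auto
    next
      case (list_emb_Cons2 u v us vs)
      with Cons.IH[of us] obtain ws where "subseq ws xs" "us = map f ws" by force
      with list_emb_Cons2 show ?thesis by (intro exI[of _ "x # ws"]) auto
    qed auto
  qed auto
  then show ?thesis using that by blast
qed

lemma order_iso_subseq:
  assumes "order_iso xs ys" "subseq zs ys"
  obtains ws where "subseq ws xs" "order_iso ws zs"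
proof -
  obtain f where f: "strict_mono_on (set xs) f" "ys = map f xs" using assms(1) by (rule order_iso_mapE)
  obtain ws where ws: "subseq ws xs" "zs = map f ws"
    using assms(2) unfolding f(2) by (rule subseq_mapE)
  have "set ws \<subseteq> set xs" using ws(1) by (rule subseq_set)
  then show ?thesis
    using that[OF ws(1)] ws(2) order_iso_mapI monotone_on_subset[OF f(1)] by metis
qed

lemma contained_in_refl [simp]: "contained_in xs xs"
  unfolding contained_in_def by (intro exI[of _ xs]) simp

lemma contained_in_trans:
  assumes "contained_in xs ys" "contained_in ys zs"
  shows "contained_in xs zs"
proof -
  obtain s t where s: "subseq s ys" "order_iso s xs" and t: "subseq t zs" "order_iso t ys"
    using assms by (auto simp: contained_in_def)
  obtain w where "subseq w t" "order_iso w s" using order_iso_subseq[OF t(2) s(1)] .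
  then show ?thesis
    unfolding contained_in_def using order_iso_trans[of w s xs] subseq_order.trans[of w t zs] s t by auto
qed

lemma order_iso_contained_in: "order_iso xs ys \<Longrightarrow> contained_in xs ys"
  unfolding contained_in_def using order_iso_sym[of xs ys] by (intro exI[of _ ys]) simp

lemma subseq_contained_in: "subseq xs ys \<Longrightarrow> contained_in xs ys"
  unfolding contained_in_def by (intro exI[of _ xs]) simp

lemma contained_in_std [simp]:
  "contained_in (std xs) ys \<longleftrightarrow> contained_in xs ys"
  "contained_in xs (std ys) \<longleftrightarrow> contained_in xs ys"
proof -
  have std: "contained_in s (std s)" "contained_in (std s) s" for s
    using order_iso_contained_in order_iso_std order_iso_sym by metis+
  show "contained_in (std xs) ys \<longleftrightarrow> contained_in xs ys"
    using contained_in_trans[OF std(1)] contained_in_trans[OF std(2)] by iprover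
  show "contained_in xs (std ys) \<longleftrightarrow> contained_in xs ys"
    using contained_in_trans[OF _ std(1)] contained_in_trans[OF _ std(2)] by iprover
qed

definition patterns :: "nat list \<Rightarrow> nat list list" where
  "patterns p = remdups (map std (subseqs p))"

lemma set_patterns: "set (patterns p) = std ` {s. subseq s p}"
  by (auto simp: patterns_def)

lemma std_in_patterns_iff: "std t \<in> set (patterns p) \<longleftrightarrow> contained_in t p"
  by (auto simp: set_patterns contained_in_def order_iso_iff_std image_iff)

lemma patterns_std: "t \<in> set (patterns p) \<Longrightarrow> std t = t"
  by (auto simp: set_patterns)

lemma in_patterns_iff: "std t = t \<Longrightarrow> t \<in> set (patterns p) \<longleftrightarrow> contained_in t p"
  using std_in_patterns_iff[of t p] by simp

section \<open>Interval copies\<close>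

text \<open>Being an interval in value, relative to the entries \<open>zs\<close>. Unlike
  consecutive integer values, this survives passing to subsequences and order-isomorphic
  lists.\<close>

definition separated :: "nat list \<Rightarrow> nat list \<Rightarrow> bool" where
  "separated xs zs \<longleftrightarrow> (\<forall>z\<in>set zs. (\<forall>x\<in>set xs. z < x) \<or> (\<forall>x\<in>set xs. x < z))"

lemma separated_mono:
  "separated xs zs \<Longrightarrow> set xs' \<subseteq> set xs \<Longrightarrow> set zs' \<subseteq> set zs \<Longrightarrow> separated xs' zs'"
  unfolding separated_def by blast

lemma separated_append: "separated xs (us @ vs) \<longleftrightarrow> separated xs us \<and> separated xs vs"
  by (auto simp: separated_def)

lemma separated_map:
  assumes "separated xs zs" "strict_mono_on S f" "set xs \<subseteq> S" "set zs \<subseteq> S"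
  shows "separated (map f xs) (map f zs)"
  unfolding separated_def
proof
  fix z assume "z \<in> set (map f zs)"
  then obtain v where v: "v \<in> set zs" "z = f v" by auto
  with assms(1) have "(\<forall>x\<in>set xs. v < x) \<or> (\<forall>x\<in>set xs. x < v)" by (simp add: separated_def)
  then show "(\<forall>x\<in>set (map f xs). z < x) \<or> (\<forall>x\<in>set (map f xs). x < z)"
    using v assms(2-4) by (auto simp: subset_iff dest: strict_mono_onD)
qed

definition interval_copy :: "nat list \<Rightarrow> nat list \<Rightarrow> bool" where
  "interval_copy P s \<longleftrightarrow> (\<exists>L xs R. s = L @ xs @ R \<and> order_iso xs P \<and> separated xs (L @ R))"

lemma interval_copyI:
  "order_iso xs P \<Longrightarrow> separated xs (L @ R) \<Longrightarrow> interval_copy P (L @ xs @ R)"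
  unfolding interval_copy_def by blast

lemma interval_copy_order_iso:
  assumes "interval_copy P s" "order_iso s s'"
  shows "interval_copy P s'"
proof -
  obtain L xs R where s: "s = L @ xs @ R" "order_iso xs P" "separated xs (L @ R)"
    using assms(1) by (auto simp: interval_copy_def)
  obtain f where f: "strict_mono_on (set s) f" "s' = map f s" using assms(2) by (rule order_iso_mapE)
  have "strict_mono_on (set xs) f" using f(1) by (rule monotone_on_subset) (use s in auto)
  then have "order_iso (map f xs) P" using s(2) order_iso_mapI order_iso_sym order_iso_trans by blast
  moreover have "separated (map f xs) (map f (L @ R))"
    using s(3) f(1) by (rule separated_map) (use s in auto)
  ultimately show ?thesis using f(2) s(1) interval_copyI[of "map f xs" P "map f L" "map f R"] by simp
qed

lemma interval_copy_trans:
  assumes "interval_copy P t" "interval_copy t s"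
  shows "interval_copy P s"
proof -
  obtain L ts R where s: "s = L @ ts @ R" "order_iso ts t" "separated ts (L @ R)"
    using assms(2) by (auto simp: interval_copy_def)
  then have "interval_copy P ts" using assms(1) interval_copy_order_iso order_iso_sym by blast
  then obtain L' xs R' where ts: "ts = L' @ xs @ R'" "order_iso xs P" "separated xs (L' @ R')"
    by (auto simp: interval_copy_def)
  have "separated xs (L @ R)" using s(3) by (rule separated_mono) (use ts in auto)
  with ts(3) have "separated xs ((L @ L') @ (R' @ R))" by (simp add: separated_append)
  from interval_copyI[OF ts(2) this] show ?thesis using s(1) ts(1) by simp
qed

lemma interval_copy_Nil: "interval_copy [] s"
  using interval_copyI[of "[]" "[]" "[]" s] by (simp add: separated_def)

definition interval_patterns :: "nat list \<Rightarrow> nat list list" where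
  "interval_patterns p = concat (map (\<lambda>i. map (\<lambda>j. std (take j (drop i p)))
     (filter (\<lambda>j. separated (take j (drop i p)) (take i p @ drop j (drop i p))) [0..<Suc (length p)]))
     [0..<length p])"

text \<open>This direction makes the check sound: a copy missing from the list could only make a
  certificate harder to pass.\<close>

lemma interval_patterns_copy:
  assumes "P \<in> set (interval_patterns t)"
  shows "interval_copy P t"
proof -
  obtain i j where ij: "separated (take j (drop i t)) (take i t @ drop j (drop i t))"
    "P = std (take j (drop i t))"
    using assms unfolding interval_patterns_def by (auto simp del: upt_Suc drop_drop)
  have "t = take i t @ take j (drop i t) @ drop j (drop i t)" by (simp only: append_take_drop_id)
  then show ?thesis using ij interval_copyI[OF order_iso_std ij(1)] by simp
qed

text \<open>Each outer entry lies on one side of all of \<open>xs\<close>, so moving the block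
  within the values of \<open>xs\<close> changes no comparison with it.\<close>

lemma order_iso_replace:
  assumes "separated xs (l @ r)" "set a \<subseteq> set xs" "set a' \<subseteq> set xs" "order_iso a a'"
  shows "order_iso (l @ a @ r) (l @ a' @ r)"
proof -
  obtain f where f: "strict_mono_on (set a) f" "a' = map f a" using assms(4) by (rule order_iso_mapE)
  define g where "g v = (if v \<in> set a then f v else v)" for v
  have sep: "(\<forall>x\<in>set xs. z < x) \<or> (\<forall>x\<in>set xs. x < z)" if "z \<in> set l \<union> set r" for z
    using assms(1) that by (auto simp: separated_def)
  have out: "z \<notin> set a" if "z \<in> set l \<union> set r" for z
    using sep[OF that] assms(2) by auto
  have fa: "f v \<in> set xs" if "v \<in> set a" for v using assms(3) f(2) that by auto
  have "strict_mono_on (set (l @ a @ r)) g"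
  proof (rule strict_mono_onI)
    fix u v assume uv: "u \<in> set (l @ a @ r)" "v \<in> set (l @ a @ r)" "u < v"
    consider "u \<in> set a" "v \<in> set a" | "u \<in> set a" "v \<notin> set a" "v \<in> set l \<union> set r"
      | "u \<notin> set a" "u \<in> set l \<union> set r" "v \<in> set a" | "u \<notin> set a" "v \<notin> set a"
      using uv by auto
    then show "g u < g v"
    proof cases
      case 1 then show ?thesis using uv strict_mono_onD[OF f(1)] by (simp add: g_def)
    next
      case 2
      then have "u \<in> set xs" using assms(2) by auto
      with 2 uv fa[of u] sep[of v] show ?thesis by (auto simp: g_def)
    next
      case 3
      then have "v \<in> set xs" using assms(2) by auto
      with 3 uv fa[of v] sep[of u] show ?thesis by (auto simp: g_def)
    qed (use uv in \<open>simp add: g_def\<close>)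
  qed
  moreover have "map g l = l" "map g r = r" "map g a = a'"
    using out f(2) by (auto simp: g_def map_idI)
  ultimately show ?thesis using order_iso_mapI[of "l @ a @ r" g] by simp
qed

section \<open>Copies that cannot overlap\<close>

definition not_nested :: "nat list \<Rightarrow> nat list \<Rightarrow> bool" where
  "not_nested P Q \<longleftrightarrow> (\<forall>i\<in>set [0..<Suc (length P)]. std (take (length Q) (drop i P)) \<noteq> std Q)"

text \<open>Here \<open>k\<close> is the length of a supposed overlap, formed by the last entries of
  a copy of \<open>P\<close> and the first of a copy of \<open>Q\<close>. The overlap is seen only
  through the two patterns, hence the two variables \<open>c\<close> and \<open>c'\<close>.\<close>

definition not_linked :: "nat list \<Rightarrow> nat list \<Rightarrow> bool" where
  "not_linked P Q \<longleftrightarrow> (\<forall>k\<in>set [1..<min (length P) (length Q)]. let m = length P - k in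
     \<not> (\<forall>z\<in>set (take m P). \<forall>c\<in>set (drop m P). \<forall>c'\<in>set (take k Q). \<forall>w\<in>set (drop k Q).
          z < c \<longleftrightarrow> c' < w))"

definition never_overlap :: "nat list \<Rightarrow> nat list \<Rightarrow> bool" where
  "never_overlap P Q \<longleftrightarrow> not_nested P Q \<and> not_nested Q P \<and> not_linked P Q \<and> not_linked Q P"

lemma not_nestedD:
  assumes "not_nested P Q" "order_iso (us @ ys @ ws) P" "order_iso ys Q"
  shows False
proof -
  obtain f where f: "strict_mono_on (set (us @ ys @ ws)) f" "P = map f (us @ ys @ ws)"
    using assms(2) by (rule order_iso_mapE)
  have "strict_mono_on (set ys) f" using f(1) by (rule monotone_on_subset) auto
  then have "order_iso (map f ys) Q" using assms(3) order_iso_mapI order_iso_sym order_iso_trans by blast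
  moreover have "map f ys = take (length Q) (drop (length us) P)"
    using order_iso_length[OF assms(3)] by (simp add: f(2))
  ultimately have "std (take (length Q) (drop (length us) P)) = std Q" by (simp add: order_iso_iff_std)
  moreover have "length us < Suc (length P)" by (simp add: f(2))
  ultimately show False using assms(1) by (auto simp: not_nested_def simp del: upt_Suc)
qed

text \<open>
  Of two linked blocks \<open>us @ vs\<close> and \<open>vs @ ws\<close> with interval values, the entries of \<open>us\<close> and of \<open>ws\<close> lie
  on opposite sides of those of \<open>vs\<close>.
\<close>

lemma not_linkedD:
  assumes "not_linked P Q" "order_iso (us @ vs) P" "order_iso (vs @ ws) Q"
    and ne: "us \<noteq> []" "vs \<noteq> []" "ws \<noteq> []"
    and sep: "separated (us @ vs) ws" "separated (vs @ ws) us"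
  shows False
proof -
  obtain f where f: "strict_mono_on (set (us @ vs)) f" "P = map f (us @ vs)"
    using assms(2) by (rule order_iso_mapE)
  obtain g where g: "strict_mono_on (set (vs @ ws)) g" "Q = map g (vs @ ws)"
    using assms(3) by (rule order_iso_mapE)
  have cut: "take (length P - length vs) P = map f us" "drop (length P - length vs) P = map f vs"
    "take (length vs) Q = map g vs" "drop (length vs) Q = map g ws"
    by (simp_all add: f(2) g(2))
  have eq: "f z < f c \<longleftrightarrow> g c' < g w"
    if "z \<in> set us" "c \<in> set vs" "c' \<in> set vs" "w \<in> set ws" for z c c' w
  proof -
    have "z < c \<and> z < c' \<and> z < w \<or> c < z \<and> c' < z \<and> w < z"
      using sep(2) that by (auto simp: separated_def)
    moreover have "w < z \<and> w < c \<and> w < c' \<or> z < w \<and> c < w \<and> c' < w"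
      using sep(1) that by (auto simp: separated_def)
    ultimately have "z < c \<longleftrightarrow> c' < w" by auto
    then show ?thesis
      using strict_mono_on_less[OF f(1), of z c] strict_mono_on_less[OF g(1), of c' w] that by simp
  qed
  have "length vs \<in> set [1..<min (length P) (length Q)]"
    using ne by (simp add: f(2) g(2) Suc_le_eq)
  from bspec[OF assms(1)[unfolded not_linked_def Let_def] this, unfolded cut set_map]
  show False using eq by auto
qed

lemma append_eq_appendD:
  assumes "xs @ ys = zs @ ts"
  shows "(\<exists>us. zs = xs @ us \<and> ys = us @ ts) \<or> (\<exists>us. xs = zs @ us \<and> ts = us @ ys)"
  using append_eq_append_conv2[THEN iffD1, OF assms] by (elim exE disjE conjE; metis)

lemma two_blocks_cases:
  assumes "L @ xs @ R = L' @ ys @ R'"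
  obtains (left) M where "L' = L @ xs @ M" "R = M @ ys @ R'"
    | (right) M where "L = L' @ ys @ M" "R' = M @ xs @ R"
    | (inner) us ws where "xs = us @ ys @ ws"
    | (outer) us ws where "ys = us @ xs @ ws"
    | (linked) us vs ws where "xs = us @ vs" "ys = vs @ ws" "L' = L @ us" "R = ws @ R'"
        "us \<noteq> []" "vs \<noteq> []" "ws \<noteq> []"
    | (linked') us vs ws where "ys = us @ vs" "xs = vs @ ws" "L = L' @ us" "R' = ws @ R"
        "us \<noteq> []" "vs \<noteq> []" "ws \<noteq> []"
proof -
  have "(\<exists>us. L' = L @ us \<and> xs @ R = us @ ys @ R') \<or> (\<exists>us. L = L' @ us \<and> ys @ R' = us @ xs @ R)"
    by (rule append_eq_appendD[OF assms])
  then show ?thesis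
  proof (elim disjE exE conjE)
    fix us assume us: "L' = L @ us" "xs @ R = us @ ys @ R'"
    show ?thesis
    proof (cases "\<exists>vs. us = xs @ vs")
      case True
      then show ?thesis using us left by (metis append.assoc same_append_eq)
    next
      case False
      then obtain vs where vs: "xs = us @ vs" "vs @ R = ys @ R'"
        using append_eq_appendD[OF us(2)] by metis
      show ?thesis
      proof (cases "\<exists>ws. vs = ys @ ws")
        case True
        then show ?thesis using inner vs(1) by metis
      next
        case F: False
        then obtain ws where "ys = vs @ ws" "R = ws @ R'"
          using append_eq_appendD[OF vs(2)] by metis
        note ws = this
        have "vs \<noteq> []" "ws \<noteq> []" using F False vs(1) ws(1) by force+
        \<comment> \<open>If \<open>us\<close> is empty, then \<open>xs\<close> is a prefix of
          \<open>ys\<close>, which is the case \<open>outer\<close>.\<close>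
        then show ?thesis
          using linked[OF vs(1) ws(1) us(1) ws(2)] outer[of "[]" ws] vs(1) ws(1) by (cases "us = []") simp_all
      qed
    qed
  next
    fix us assume us: "L = L' @ us" "ys @ R' = us @ xs @ R"
    show ?thesis
    proof (cases "\<exists>vs. us = ys @ vs")
      case True
      then show ?thesis using us right by (metis append.assoc same_append_eq)
    next
      case False
      then obtain vs where vs: "ys = us @ vs" "vs @ R' = xs @ R"
        using append_eq_appendD[OF us(2)] by metis
      show ?thesis
      proof (cases "\<exists>ws. vs = xs @ ws")
        case True
        then show ?thesis using outer vs(1) by metis
      next
        case F: False
        then obtain ws where "xs = vs @ ws" "R' = ws @ R"
          using append_eq_appendD[OF vs(2)] by metis
        note ws = this
        have "vs \<noteq> []" "ws \<noteq> []" using F False vs(1) ws(1) by force+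
        then show ?thesis
          using linked'[OF vs(1) ws(1) us(1) ws(2)] inner[of "[]" ws] vs(1) ws(1) by (cases "us = []") simp_all
      qed
    qed
  qed
qed


lemma never_overlap_cases:
  assumes "distinct s" "interval_copy P s" "interval_copy Q s" "never_overlap P Q"
  obtains L xs M ys R where "s = L @ xs @ M @ ys @ R"
    "order_iso xs P \<and> order_iso ys Q \<or> order_iso xs Q \<and> order_iso ys P"
    "separated xs (L @ M @ ys @ R)" "separated ys (L @ xs @ M @ R)"
proof -
  obtain L xs R where s: "s = L @ xs @ R" and xs: "order_iso xs P" "separated xs (L @ R)"
    using assms(2) by (auto simp: interval_copy_def)
  obtain L' ys R' where s': "s = L' @ ys @ R'" and ys: "order_iso ys Q" "separated ys (L' @ R')"
    using assms(3) by (auto simp: interval_copy_def)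
  have no: "not_nested P Q" "not_nested Q P" "not_linked P Q" "not_linked Q P"
    using assms(4) by (auto simp: never_overlap_def)
  have "L @ xs @ R = L' @ ys @ R'" using s s' by simp
  then show ?thesis
  proof (cases rule: two_blocks_cases)
    case (left M)
    then show ?thesis using that[of L xs M ys R'] s xs ys by simp
  next
    case (right M)
    then show ?thesis using that[of L' ys M xs R] s' xs ys by simp
  next
    case (inner us ws)
    then show ?thesis using not_nestedD[OF no(1) _ ys(1)] xs(1) by metis
  next
    case (outer us ws)
    then show ?thesis using not_nestedD[OF no(2) _ xs(1)] ys(1) by metis
  next
    case (linked us vs ws)
    have "separated (us @ vs) ws" "separated (vs @ ws) us"
      using xs(2) ys(2) linked by (auto simp: separated_append)
    then show ?thesis using not_linkedD[OF no(3), of us vs ws] linked xs(1) ys(1) by simp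
  next
    case (linked' us vs ws)
    have "separated (us @ vs) ws" "separated (vs @ ws) us"
      using xs(2) ys(2) linked' by (auto simp: separated_append)
    then show ?thesis using not_linkedD[OF no(4), of us vs ws] linked' xs(1) ys(1) by simp
  qed
qed

section \<open>Reducing two disjoint interval copies\<close>

text \<open>
  \<open>A x y\<close> is obtained from \<open>s\<close> by shrinking its copies of \<open>P\<close> and \<open>Q\<close> to \<open>x\<close> and \<open>y\<close>; \<open>Tr \<tau>\<close> collects, over
  all embeddings of \<open>\<tau>\<close> into \<open>s\<close>, the pairs of patterns in which the embedding meets the two copies.
\<close>

definition reduction :: "nat list \<Rightarrow> nat list \<Rightarrow> nat list \<Rightarrow> (nat list \<Rightarrow> nat list \<Rightarrow> nat list) \<Rightarrow>
    (nat list \<Rightarrow> (nat list \<times> nat list) set) \<Rightarrow> bool" where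
  "reduction P Q s A Tr \<longleftrightarrow> length P + length Q \<le> length s \<and>
     (\<forall>x y. contained_in x P \<longrightarrow> contained_in y Q \<longrightarrow>
        distinct (A x y) \<and> contained_in (A x y) s \<and>
        length (A x y) + length P + length Q = length s + length x + length y \<and>
        (\<forall>\<tau>. contained_in \<tau> (A x y) \<longleftrightarrow> (\<exists>(t, u)\<in>Tr \<tau>. contained_in t x \<and> contained_in u y))) \<and>
     (\<forall>\<tau>. contained_in \<tau> s \<longrightarrow> Tr \<tau> \<noteq> {}) \<and>
     (\<forall>\<tau> t u. (t, u) \<in> Tr \<tau> \<longrightarrow> t \<in> set (patterns P) \<and> u \<in> set (patterns Q) \<and>
        interval_copy t \<tau> \<and> interval_copy u \<tau>)"

lemma reduction_swap:
  assumes "reduction P Q s A Tr"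
  shows "reduction Q P s (\<lambda>x y. A y x) (\<lambda>\<tau>. prod.swap ` Tr \<tau>)"
  using assms unfolding reduction_def by (simp add: ac_simps case_prod_beta conj_commute image_iff) fastforce

lemma contained_in_order_iso: "contained_in x P \<Longrightarrow> order_iso xs P \<Longrightarrow> \<exists>x'. subseq x' xs \<and> order_iso x' x"
  unfolding contained_in_def by (metis order_iso_subseq order_iso_trans)

lemma subseq_append5:
  assumes "subseq e (L @ xs @ M @ ys @ R)"
  obtains l a m b r where "e = l @ a @ m @ b @ r" "subseq l L" "subseq a xs" "subseq m M" "subseq b ys" "subseq r R"
  using assms by (metis subseq_appendE)

text \<open>For each \<open>x\<close> one occurrence \<open>X x\<close> inside \<open>xs\<close> is
  fixed, and likewise \<open>Y y\<close>. An embedding into \<open>s\<close> whose traces have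
  patterns below \<open>x\<close> and \<open>y\<close> can be pushed into these occurrences, because
  its entries elsewhere do not notice the exchange.\<close>

lemma reduction_exists:
  assumes s: "s = L @ xs @ M @ ys @ R" "distinct s" and iso: "order_iso xs P" "order_iso ys Q"
    and sep: "separated xs (L @ M @ ys @ R)" "separated ys (L @ xs @ M @ R)"
  obtains A Tr where "reduction P Q s A Tr"
proof -
  define X where "X x = (SOME x'. subseq x' xs \<and> order_iso x' x)" for x
  define Y where "Y y = (SOME y'. subseq y' ys \<and> order_iso y' y)" for y
  have X: "subseq (X x) xs" "order_iso (X x) x" if "contained_in x P" for x
    using someI_ex[OF contained_in_order_iso[OF that iso(1)]] by (simp_all add: X_def)
  have Y: "subseq (Y y) ys" "order_iso (Y y) y" if "contained_in y Q" for y
    using someI_ex[OF contained_in_order_iso[OF that iso(2)]] by (simp_all add: Y_def)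
  define A where "A x y = L @ X x @ M @ Y y @ R" for x y
  define Tr where "Tr \<tau> = {(std a, std b) | l a m b r. subseq l L \<and> subseq a xs \<and> subseq m M \<and>
    subseq b ys \<and> subseq r R \<and> order_iso (l @ a @ m @ b @ r) \<tau>}" for \<tau>
  have TrI: "(std a, std b) \<in> Tr \<tau>"
    if "subseq l L" "subseq a xs" "subseq m M" "subseq b ys" "subseq r R" "order_iso (l @ a @ m @ b @ r) \<tau>"
    for l a m b r \<tau>
    using that unfolding Tr_def by blast
  have A_iff: "contained_in \<tau> (A x y) \<longleftrightarrow> (\<exists>(t, u)\<in>Tr \<tau>. contained_in t x \<and> contained_in u y)"
    if xy: "contained_in x P" "contained_in y Q" for x y \<tau>
  proof
    assume "contained_in \<tau> (A x y)"
    then obtain e where e: "subseq e (L @ X x @ M @ Y y @ R)" "order_iso e \<tau>"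
      by (auto simp: contained_in_def A_def)
    from e(1) obtain l a m b r where lr: "e = l @ a @ m @ b @ r" "subseq l L" "subseq a (X x)" "subseq m M"
      "subseq b (Y y)" "subseq r R" by (rule subseq_append5)
    have "(std a, std b) \<in> Tr \<tau>"
      using TrI[of l a m b r \<tau>] lr e(2) subseq_order.trans[OF lr(3) X(1)[OF xy(1)]]
        subseq_order.trans[OF lr(5) Y(1)[OF xy(2)]] by simp
    moreover have "contained_in a x"
      using contained_in_trans[OF subseq_contained_in[OF lr(3)] order_iso_contained_in[OF X(2)[OF xy(1)]]] .
    moreover have "contained_in b y"
      using contained_in_trans[OF subseq_contained_in[OF lr(5)] order_iso_contained_in[OF Y(2)[OF xy(2)]]] .
    ultimately show "\<exists>(t, u)\<in>Tr \<tau>. contained_in t x \<and> contained_in u y"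
      by (intro bexI[of _ "(std a, std b)"]) simp_all
  next
    assume "\<exists>(t, u)\<in>Tr \<tau>. contained_in t x \<and> contained_in u y"
    then obtain l a m b r where lr: "subseq l L" "subseq a xs" "subseq m M" "subseq b ys" "subseq r R"
      "order_iso (l @ a @ m @ b @ r) \<tau>" and ab: "contained_in a x" "contained_in b y"
      unfolding Tr_def by force
    obtain a' where a': "subseq a' (X x)" "order_iso a' a"
      using contained_in_order_iso[OF ab(1) X(2)[OF xy(1)]] by auto
    obtain b' where b': "subseq b' (Y y)" "order_iso b' b"
      using contained_in_order_iso[OF ab(2) Y(2)[OF xy(2)]] by auto
    have sub: "set l \<subseteq> set L" "set a \<subseteq> set xs" "set m \<subseteq> set M" "set b \<subseteq> set ys" "set r \<subseteq> set R"
      using lr by (simp_all add: subseq_set)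
    have sub': "set a' \<subseteq> set xs" "set b' \<subseteq> set ys"
      using subseq_set[OF a'(1)] subseq_set[OF X(1)[OF xy(1)]] subseq_set[OF b'(1)] subseq_set[OF Y(1)[OF xy(2)]]
      by auto
    \<comment> \<open>The blocks are exchanged one at a time: \<open>a'\<close> against
      \<open>a\<close> beside \<open>b'\<close>, and then \<open>b'\<close> against
      \<open>b\<close>.\<close>
    have "separated xs (l @ m @ b' @ r)"
      using sep(1) by (rule separated_mono) (use sub sub' in auto)
    then have 1: "order_iso (l @ a' @ m @ b' @ r) (l @ a @ m @ b' @ r)"
      using order_iso_replace[of xs l "m @ b' @ r" a' a] sub sub' a'(2) by simp
    have "separated ys ((l @ a @ m) @ r)"
      using sep(2) by (rule separated_mono) (use sub sub' in auto)
    then have 2: "order_iso (l @ a @ m @ b' @ r) (l @ a @ m @ b @ r)"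
      using order_iso_replace[of ys "l @ a @ m" r b' b] sub sub' b'(2) by simp
    have "order_iso (l @ a' @ m @ b' @ r) \<tau>"
      using order_iso_trans[OF order_iso_trans[OF 1 2] lr(6)] .
    moreover have "subseq (l @ a' @ m @ b' @ r) (A x y)"
      unfolding A_def using lr a'(1) b'(1) by (intro list_emb_append_mono)
    ultimately show "contained_in \<tau> (A x y)" unfolding contained_in_def by blast
  qed
  have size: "distinct (A x y)" "contained_in (A x y) s"
      "length (A x y) + length P + length Q = length s + length x + length y"
    if xy: "contained_in x P" "contained_in y Q" for x y
  proof -
    have sub: "subseq (A x y) s"
      unfolding A_def s(1) using X(1)[OF xy(1)] Y(1)[OF xy(2)] by (intro list_emb_append_mono) auto
    show "distinct (A x y)" using subseqs_distinctD[of "A x y" s] sub s(2) by simp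
    show "contained_in (A x y) s" using subseq_contained_in[OF sub] .
    show "length (A x y) + length P + length Q = length s + length x + length y"
      using order_iso_length[OF iso(1)] order_iso_length[OF iso(2)] order_iso_length[OF X(2)[OF xy(1)]]
        order_iso_length[OF Y(2)[OF xy(2)]] by (simp add: A_def s(1))
  qed
  have Tr_ne: "Tr \<tau> \<noteq> {}" if \<tau>: "contained_in \<tau> s" for \<tau>
  proof -
    obtain e where e: "subseq e (L @ xs @ M @ ys @ R)" "order_iso e \<tau>"
      using \<tau> by (auto simp: contained_in_def s(1))
    from e(1) obtain l a m b r where lr: "e = l @ a @ m @ b @ r" "subseq l L" "subseq a xs" "subseq m M"
      "subseq b ys" "subseq r R" by (rule subseq_append5)
    then show ?thesis using TrI[of l a m b r \<tau>] e(2) by auto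
  qed
  have Tr_copy: "t \<in> set (patterns P) \<and> u \<in> set (patterns Q) \<and> interval_copy t \<tau> \<and> interval_copy u \<tau>"
    if tu: "(t, u) \<in> Tr \<tau>" for t u \<tau>
  proof -
    obtain l a m b r where lr: "subseq l L" "subseq a xs" "subseq m M" "subseq b ys" "subseq r R"
      "order_iso (l @ a @ m @ b @ r) \<tau>" and ab: "t = std a" "u = std b"
      using tu unfolding Tr_def by auto
    have sub: "set l \<subseteq> set L" "set a \<subseteq> set xs" "set m \<subseteq> set M" "set b \<subseteq> set ys" "set r \<subseteq> set R"
      using lr by (simp_all add: subseq_set)
    have "contained_in a P" "contained_in b Q"
      using contained_in_trans[OF subseq_contained_in[OF lr(2)] order_iso_contained_in[OF iso(1)]]
        contained_in_trans[OF subseq_contained_in[OF lr(4)] order_iso_contained_in[OF iso(2)]] .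
    moreover have "separated a (l @ m @ b @ r)" "separated b ((l @ a @ m) @ r)"
      by (rule separated_mono[OF sep(1)], use sub in auto) (rule separated_mono[OF sep(2)], use sub in auto)
    then have "interval_copy (std a) \<tau>" "interval_copy (std b) \<tau>"
      using interval_copy_order_iso[OF interval_copyI[OF order_iso_std[of a], of l "m @ b @ r"] lr(6)]
        interval_copyI[OF order_iso_std[of b], of "l @ a @ m" r] interval_copy_order_iso[of "std b", OF _ lr(6)]
      by simp_all
    ultimately show ?thesis by (simp add: ab std_in_patterns_iff)
  qed
  have "reduction P Q s A Tr"
    unfolding reduction_def using A_iff size Tr_ne Tr_copy order_iso_length[OF iso(1)] order_iso_length[OF iso(2)]
    by (intro conjI allI impI) (auto simp: s(1))
  then show ?thesis by (rule that)
qed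

section \<open>Weighted cancellation\<close>

lemma contained_in_one_iff: "contained_in [1] \<tau> \<longleftrightarrow> \<tau> \<noteq> []"
proof
  assume "\<tau> \<noteq> []"
  then obtain v vs where \<tau>: "\<tau> = v # vs" by (cases \<tau>) auto
  have "subseq [v] \<tau>" "order_iso [v] [1]" by (simp_all add: \<tau> order_iso_def)
  then show "contained_in [1] \<tau>" unfolding contained_in_def by blast
qed (use contained_in_length[of "[1]" \<tau>] in auto)

definition below :: "nat list \<Rightarrow> nat list set" where
  "below p = {\<tau>. is_perm \<tau> \<and> \<tau> \<noteq> [] \<and> contained_in \<tau> p}"

lemma finite_below: "finite (below p)"
  using finite_contained_in[of p] by (rule rev_finite_subset) (auto simp: below_def)

text \<open>The recursion for \<open>mobius\<close>, read as a sum over the whole interval from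
  \<open>[1]\<close> to \<open>p\<close>. The length bound excludes \<open>p = [1]\<close>, where
  the sum is 1.\<close>

lemma sum_mobius_below_perm:
  assumes "is_perm p" "2 \<le> length p"
  shows "(\<Sum>\<tau>\<in>below p. mobius [1] \<tau>) = 0"
proof -
  have one: "is_perm [1]" by (simp add: is_perm_def)
  have p: "p \<noteq> []" "[1] \<noteq> p" using assms(2) by auto
  have "mobius [1] p = - (\<Sum>\<tau>\<in>{\<tau>. is_perm \<tau> \<and> contained_in [1] \<tau> \<and> contained_in \<tau> p \<and> \<tau> \<noteq> p}. mobius [1] \<tau>)"
    using mobius.simps[of "[1]" p] one assms(1) p contained_in_one_iff[of p] by simp
  also have "{\<tau>. is_perm \<tau> \<and> contained_in [1] \<tau> \<and> contained_in \<tau> p \<and> \<tau> \<noteq> p} = below p - {p}"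
    by (auto simp: below_def contained_in_one_iff[unfolded One_nat_def])
  finally show ?thesis
    using sum.remove[OF finite_below[of p], of p "mobius [1]"] assms(1) p by (simp add: below_def)
qed

lemma sum_mobius_below:
  assumes "distinct s" "2 \<le> length s"
  shows "(\<Sum>\<tau>\<in>below s. mobius [1] \<tau>) = 0"
  using sum_mobius_below_perm[OF is_perm_std[OF assms(1)]] assms(2) by (simp add: below_def)

text \<open>Inserting the factor 1 and exchanging the summations turns the sum over all \<tau>
  strictly below \<open>std s\<close> into a weighted sum of sums over \<open>below (A i)\<close>,
  each of which is 0. The value at \<open>std s\<close> is what remains of the zero sum over
  \<open>below s\<close>.\<close>

lemma mobius_eq_0_by_weights:
  fixes w :: "'i \<Rightarrow> int"
  assumes s: "distinct s" "2 \<le> length s" and I: "finite I"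
    and A: "\<And>i. i \<in> I \<Longrightarrow> distinct (A i) \<and> contained_in (A i) s \<and> 2 \<le> length (A i) \<and> length (A i) < length s"
    and w: "\<And>\<tau>. is_perm \<tau> \<Longrightarrow> contained_in \<tau> s \<Longrightarrow> length \<tau> < length s \<Longrightarrow> mobius [1] \<tau> \<noteq> 0 \<Longrightarrow>
      (\<Sum>i | i \<in> I \<and> contained_in \<tau> (A i). w i) = 1"
  shows "mobius [1] (std s) = 0"
proof -
  define B where "B = below s - {std s}"
  have "std s \<noteq> []" using s(2) length_std[of s] by force
  then have p: "std s \<in> below s" using is_perm_std[OF s(1)] by (simp add: below_def)
  have short: "length \<tau> < length s" if "\<tau> \<in> B" for \<tau>
    using contained_in_length_less[of \<tau> "std s"] that is_perm_std[OF s(1)] by (simp add: B_def below_def)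
  have sub: "below (A i) \<subseteq> B" if "i \<in> I" for i
  proof
    fix \<tau> assume \<tau>: "\<tau> \<in> below (A i)"
    then have "length \<tau> < length s" using A[OF that] contained_in_length[of \<tau> "A i"] by (simp add: below_def)
    moreover have "contained_in \<tau> s" using \<tau> A[OF that] contained_in_trans[of \<tau> "A i" s] by (simp add: below_def)
    ultimately show "\<tau> \<in> B" using \<tau> by (auto simp: B_def below_def)
  qed
  have fin: "finite B" by (simp add: B_def finite_below)
  have "(\<Sum>\<tau>\<in>B. mobius [1] \<tau>) = (\<Sum>\<tau>\<in>B. mobius [1] \<tau> * (\<Sum>i | i \<in> I \<and> contained_in \<tau> (A i). w i))"
  proof (rule sum.cong)
    fix \<tau> assume "\<tau> \<in> B"
    then have "mobius [1] \<tau> = 0 \<or> (\<Sum>i | i \<in> I \<and> contained_in \<tau> (A i). w i) = 1"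
      using w[of \<tau>] short[of \<tau>] unfolding B_def below_def by blast
    then show "mobius [1] \<tau> = mobius [1] \<tau> * (\<Sum>i | i \<in> I \<and> contained_in \<tau> (A i). w i)"
      by (elim disjE) simp_all
  qed simp
  also have "\<dots> = (\<Sum>\<tau>\<in>B. \<Sum>i\<in>I. if contained_in \<tau> (A i) then mobius [1] \<tau> * w i else 0)"
    unfolding sum_distrib_left by (simp only: sum.inter_filter[OF I])
  also have "\<dots> = (\<Sum>i\<in>I. \<Sum>\<tau>\<in>B. if contained_in \<tau> (A i) then mobius [1] \<tau> * w i else 0)"
    by (rule sum.swap)
  also have "\<dots> = (\<Sum>i\<in>I. \<Sum>\<tau>\<in>below (A i). mobius [1] \<tau> * w i)"
  proof (rule sum.cong)
    fix i assume i: "i \<in> I"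
    have "{\<tau> \<in> B. contained_in \<tau> (A i)} = below (A i)" using sub[OF i] by (auto simp: B_def below_def)
    then show "(\<Sum>\<tau>\<in>B. if contained_in \<tau> (A i) then mobius [1] \<tau> * w i else 0) = (\<Sum>\<tau>\<in>below (A i). mobius [1] \<tau> * w i)"
      using sum.inter_filter[OF fin, of "\<lambda>\<tau>. mobius [1] \<tau> * w i" "\<lambda>\<tau>. contained_in \<tau> (A i)"] by simp
  qed simp
  also have "\<dots> = 0"
    unfolding sum_distrib_right[symmetric] using A sum_mobius_below by (intro sum.neutral ballI) simp
  finally have "(\<Sum>\<tau>\<in>B. mobius [1] \<tau>) = 0" .
  then show ?thesis
    using sum.remove[OF finite_below p, of "mobius [1]"] sum_mobius_below[OF s] by (simp add: B_def)
qed


section \<open>A decision procedure for pairs of interval copies\<close>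

text \<open>
  The copies may overlap or coincide. As every list has an interval copy of \<open>[]\<close>, a single pattern \<open>P\<close>
  is treated below as the pair \<open>[P, []]\<close>.
\<close>

definition annihilating :: "nat list list \<Rightarrow> bool" where
  "annihilating F \<longleftrightarrow> (\<forall>s. distinct s \<longrightarrow> (\<forall>P\<in>set F. interval_copy P s) \<longrightarrow> mobius [1] (std s) = 0)"

type_synonym weighting = "((nat list \<times> nat list) \<times> int) list"
type_synonym profile = "nat list \<times> nat list list"

text \<open>
  For the given weighting \<open>X\<close>, the profile of a pair \<open>(t, u)\<close> lists the indices of the entries of \<open>X\<close> above
  \<open>(t, u)\<close> and the patterns of which \<open>t\<close> or \<open>u\<close> has an interval copy. The definitions below use \<open>if\<close> for
  conjunctions and avoid \<open>let\<close> and most abstractions because \<open>code_simp\<close> evaluates both sides of a conjunction and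
  simplifies under binders.
\<close>

fun hits :: "nat list \<Rightarrow> nat \<Rightarrow> nat list list list \<Rightarrow> nat list" where
  "hits t n [] = []"
| "hits t n (ps # T) = (if List.member ps t then n # hits t (Suc n) T else hits t (Suc n) T)"

definition half_profile :: "nat list list \<Rightarrow> nat list list list \<Rightarrow> nat list \<Rightarrow> profile" where
  "half_profile Ps T t = (hits t 0 T, filter (List.member (interval_patterns t)) Ps)"

text \<open>A pair lies below an entry iff both components do, so index lists are intersected; a
  copy in either component is a copy in \<tau>, so pattern lists are united.\<close>

definition join :: "profile \<times> profile \<Rightarrow> profile" where
  "join p = (filter (List.member (fst (fst p))) (fst (snd p)), remdups (snd (fst p) @ snd (snd p)))"

definition half_profiles :: "nat list list list \<Rightarrow> nat list list \<Rightarrow> nat list \<Rightarrow> profile list" where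
  "half_profiles Fs xs P = map (half_profile (remdups (concat Fs)) (map patterns xs)) (patterns P)"

definition vanish :: "nat list list list \<Rightarrow> profile \<Rightarrow> profile \<Rightarrow> bool" where
  "vanish Fs a b \<longleftrightarrow> list_ex (list_all (List.member (snd a @ snd b))) Fs"

text \<open>Selects the profiles \<open>b\<close> that still have to be combined with
  \<open>a\<close>: possibly met by the same \<tau> of nonzero value, and with an index set
  incomparable to that of \<open>a\<close>.\<close>

definition clash :: "nat list list list \<Rightarrow> profile \<Rightarrow> profile \<Rightarrow> bool" where
  "clash Fs a b = (if list_all (List.member (fst b)) (fst a) then False
     else if list_all (List.member (fst a)) (fst b) then False else \<not> vanish Fs a b)"

definition nonvanish :: "nat list list list \<Rightarrow> profile \<Rightarrow> bool" where
  "nonvanish Fs a \<longleftrightarrow> \<not> vanish Fs a a"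

fun weight :: "nat list \<Rightarrow> nat \<Rightarrow> int list \<Rightarrow> int" where
  "weight U n [] = 0"
| "weight U n (w # ws) = (if List.member U n then w + weight U (Suc n) ws else weight U (Suc n) ws)"

text \<open>
  The recursion runs over the sets of profiles that are pairwise not known to vanish; a profile whose
  index set is contained in another one contributes nothing to the union \<open>U\<close>, so such pairs are skipped.
\<close>

fun balanced :: "nat list list list \<Rightarrow> int list \<Rightarrow> nat list \<Rightarrow> profile list \<Rightarrow> bool" where
  "balanced Fs ws U [] = (if U = [] then True else weight U 0 ws = 1)"
| "balanced Fs ws U (a # as) =
     (if balanced Fs ws (remdups (fst a @ U)) (filter (clash Fs a) as) then balanced Fs ws U as else False)"

definition profiles :: "nat list list list \<Rightarrow> weighting \<Rightarrow> nat list \<Rightarrow> nat list \<Rightarrow> profile list" where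
  "profiles Fs X P Q = remdups (filter (nonvanish Fs) (map join
     (List.product (half_profiles Fs (map (fst \<circ> fst) X) P) (half_profiles Fs (map (snd \<circ> fst) X) Q))))"

text \<open>\<open>balanced\<close> accepts an empty union, as it arises from the empty set of
  profiles. A profile without indices would slip through there with weight sum 0, so it is excluded
  here.\<close>

definition balanced_profiles :: "nat list list list \<Rightarrow> int list \<Rightarrow> profile list \<Rightarrow> bool" where
  "balanced_profiles Fs ws as = (if list_ex (\<lambda>a. fst a = []) as then False else balanced Fs ws [] as)"

text \<open>The upper bound makes \<open>A x y\<close> shorter than \<open>s\<close>; the lower one
  gives it length at least two even if \<open>s\<close> consists of the two copies alone.\<close>

definition admissible :: "nat list \<Rightarrow> nat list \<Rightarrow> weighting \<Rightarrow> bool" where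
  "admissible P Q X \<longleftrightarrow> (\<forall>((x, y), w)\<in>set X. x \<in> set (patterns P) \<and> y \<in> set (patterns Q) \<and>
     length x + length y < length P + length Q \<and> 2 \<le> length x + length y)"

text \<open>Adding \<open>[P, Q]\<close> to \<open>Fs\<close> makes the induction hypothesis
  available to the check. The case \<open>Q = []\<close> is separate because
  \<open>never_overlap P []\<close> is false.\<close>

definition certified :: "nat list \<Rightarrow> nat list \<Rightarrow> weighting \<Rightarrow> nat list list list \<Rightarrow> bool" where
  "certified P Q X Fs \<longleftrightarrow> 2 \<le> length P \<and> (Q = [] \<or> never_overlap P Q) \<and> admissible P Q X \<and>
     balanced_profiles ([P, Q] # Fs) (map snd X) (profiles ([P, Q] # Fs) X P Q)"

section \<open>Soundness of the decision procedure\<close>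

lemma in_set_hits: "k \<in> set (hits t n T) \<longleftrightarrow> (\<exists>i<length T. k = n + i \<and> t \<in> set (T ! i))"
  by (induction T arbitrary: n) (simp_all add: Ex_less_Suc2)

lemma weight_eq: "weight U n ws = (\<Sum>i<length ws. if n + i \<in> set U then ws ! i else 0)"
proof (induction ws arbitrary: n)
  case (Cons w ws)
  show ?case by (simp add: Cons.IH sum.lessThan_Suc_shift del: sum.lessThan_Suc cong: if_cong)
qed simp

text \<open>Induction along the recursion. If \<open>a\<close> is not in \<open>T\<close>, or its
  indices are covered by another member of \<open>T\<close>, the branch skipping \<open>a\<close>
  applies. Otherwise the branch taking \<open>a\<close> does.\<close>

lemma balanced_weight:
  assumes "balanced Fs ws U as" "T \<subseteq> set as" "\<And>a b. a \<in> T \<Longrightarrow> b \<in> T \<Longrightarrow> \<not> vanish Fs a b"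
    "set U \<union> (\<Union>a\<in>T. set (fst a)) \<noteq> {}"
  shows "(\<Sum>i<length ws. if i \<in> set U \<union> (\<Union>a\<in>T. set (fst a)) then ws ! i else 0) = 1"
  using assms
proof (induction Fs ws U as arbitrary: T rule: balanced.induct)
  case (1 Fs ws U)
  then show ?case by (auto simp: weight_eq split: if_splits)
next
  case (2 Fs ws U a as)
  have bal: "balanced Fs ws (remdups (fst a @ U)) (filter (clash Fs a) as)" "balanced Fs ws U as"
    using 2(3) by (auto split: if_splits)
  consider "a \<notin> T" | d where "a \<in> T" "d \<in> T" "d \<noteq> a" "set (fst a) \<subseteq> set (fst d)"
    | "a \<in> T" "\<forall>d\<in>T. d \<noteq> a \<longrightarrow> \<not> set (fst a) \<subseteq> set (fst d)"
    by blast
  then show ?case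
  proof cases
    case 1
    then have "T \<subseteq> set as" using 2(4) by auto
    from 2(2)[OF bal(1) bal(2) this 2(5,6)] show ?thesis .
  next
    case (2 d)
    then have U: "(\<Union>a\<in>T. set (fst a)) = (\<Union>a\<in>T - {a}. set (fst a))" by auto
    have "T - {a} \<subseteq> set as" using \<open>T \<subseteq> set (a # as)\<close> by auto
    from "2.IH"(2)[OF bal(1) bal(2) this] "2.prems"(3,4) show ?thesis unfolding U by blast
  next
    case 3
    \<comment> \<open>Members whose indices lie inside those of \<open>a\<close> add nothing to the
      union; all the others clash with \<open>a\<close> and so survive the filter.\<close>
    define T' where "T' = {d \<in> T. d \<noteq> a \<and> \<not> set (fst d) \<subseteq> set (fst a)}"
    have T': "T' \<subseteq> set (filter (clash Fs a) as)"
    proof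
      fix d assume d: "d \<in> T'"
      then have "\<not> vanish Fs a d" using 3(1) "2.prems"(3) by (simp add: T'_def)
      with d 3 "2.prems"(2) show "d \<in> set (filter (clash Fs a) as)"
        by (auto simp: T'_def clash_def list_all_iff)
    qed
    have U: "set U \<union> (\<Union>a\<in>T. set (fst a)) = set (remdups (fst a @ U)) \<union> (\<Union>a\<in>T'. set (fst a))"
      using 3(1) by (auto simp: T'_def)
    have "\<not> vanish Fs b c" if "b \<in> T'" "c \<in> T'" for b c
      using that "2.prems"(3) by (simp add: T'_def)
    from "2.IH"(1)[OF bal(1) T' this] "2.prems"(4) show ?thesis unfolding U by blast
  qed
qed


definition profile :: "nat list list list \<Rightarrow> weighting \<Rightarrow> nat list \<times> nat list \<Rightarrow> profile" where
  "profile Fs X p = join (half_profile (remdups (concat Fs)) (map (patterns \<circ> (fst \<circ> fst)) X) (fst p),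
     half_profile (remdups (concat Fs)) (map (patterns \<circ> (snd \<circ> fst)) X) (snd p))"

lemma set_profiles:
  "set (profiles Fs X P Q) =
     {a \<in> profile Fs X ` (set (patterns P) \<times> set (patterns Q)). \<not> vanish Fs a a}"
  by (force simp: profiles_def half_profiles_def profile_def nonvanish_def)

lemma fst_profile:
  assumes "t \<in> set (patterns P)" "u \<in> set (patterns Q)"
  shows "set (fst (profile Fs X (t, u))) =
     {i. i < length X \<and> contained_in t (fst (fst (X ! i))) \<and> contained_in u (snd (fst (X ! i)))}"
  using in_patterns_iff[OF patterns_std[OF assms(1)]] in_patterns_iff[OF patterns_std[OF assms(2)]]
  by (auto simp: profile_def join_def half_profile_def in_set_hits)

lemma snd_profile:
  assumes "R \<in> set (snd (profile Fs X (t, u)))" "interval_copy t \<tau>" "interval_copy u \<tau>"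
  shows "interval_copy R \<tau>"
  using assms(1) interval_copy_trans[OF interval_patterns_copy assms(2)]
    interval_copy_trans[OF interval_patterns_copy assms(3)]
  by (auto simp: profile_def join_def half_profile_def)

text \<open>For a shorter \<tau> of nonzero value, the profiles of the pairs in
  \<open>Tr \<tau>\<close> are pairwise non-vanishing, since all patterns they list have interval
  copies in this one \<tau>. Then \<open>balanced_weight\<close> supplies the weight condition of
  \<open>mobius_eq_0_by_weights\<close>.\<close>

theorem annihilating_if_certified:
  assumes cert: "certified P Q X Fs" and Fs: "\<forall>F\<in>set Fs. annihilating F"
  shows "annihilating [P, Q]"
  unfolding annihilating_def
proof (intro allI impI)
  fix s assume "distinct s" "\<forall>R\<in>set [P, Q]. interval_copy R s"
  then show "mobius [1] (std s) = 0"
  proof (induction s rule: length_induct)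
    case (1 s)
    have s: "distinct s" "interval_copy P s" "interval_copy Q s" using 1 by auto
    have PQ: "2 \<le> length P" "Q = [] \<or> never_overlap P Q" and adm: "admissible P Q X"
      and bal: "balanced_profiles ([P, Q] # Fs) (map snd X) (profiles ([P, Q] # Fs) X P Q)"
      using cert by (auto simp: certified_def)
    define x y where "x i = fst (fst (X ! i))" and "y i = snd (fst (X ! i))" for i
    obtain A Tr where red: "reduction P Q s A Tr"
    proof (cases "Q = []")
      case True
      obtain L xs R where lr: "s = L @ xs @ R" "order_iso xs P" "separated xs (L @ R)"
        using s(2) by (auto simp: interval_copy_def)
      \<comment> \<open>A single copy becomes a pair by placing an empty second block right after
        it.\<close>
      have 1: "s = L @ xs @ [] @ [] @ R" "order_iso [] Q" "separated xs (L @ [] @ [] @ R)"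
        "separated [] (L @ xs @ [] @ R)"
        using lr True by (simp_all add: separated_def)
      show ?thesis by (rule reduction_exists[OF 1(1) s(1) lr(2) 1(2,3,4)]) (rule that)
    next
      case False
      then have "never_overlap P Q" using PQ(2) by simp
      then obtain L xs M ys R where lr: "s = L @ xs @ M @ ys @ R"
        "order_iso xs P \<and> order_iso ys Q \<or> order_iso xs Q \<and> order_iso ys P"
        "separated xs (L @ M @ ys @ R)" "separated ys (L @ xs @ M @ R)"
        by (rule never_overlap_cases[OF s])
      from lr(2) show ?thesis
      proof
        assume "order_iso xs P \<and> order_iso ys Q"
        then show ?thesis using reduction_exists[OF lr(1) s(1) _ _ lr(3,4)] that by blast
      next
        assume "order_iso xs Q \<and> order_iso ys P"
        then obtain A Tr where "reduction Q P s A Tr"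
          using reduction_exists[OF lr(1) s(1) _ _ lr(3,4)] by blast
        from that[OF reduction_swap[OF this]] show ?thesis .
      qed
    qed
    have Tr: "Tr \<tau> \<noteq> {}" if "contained_in \<tau> s" for \<tau>
      using red that by (simp add: reduction_def)
    have TrD: "t \<in> set (patterns P) \<and> u \<in> set (patterns Q) \<and> interval_copy t \<tau> \<and> interval_copy u \<tau>"
      if "(t, u) \<in> Tr \<tau>" for t u \<tau>
      using red that by (simp add: reduction_def)
    have len: "length P + length Q \<le> length s" using red by (simp add: reduction_def)
    have xy: "contained_in (x i) P" "contained_in (y i) Q" "length (x i) + length (y i) < length P + length Q"
      "2 \<le> length (x i) + length (y i)" if "i < length X" for i
    proof -
      have "X ! i \<in> set X" using that by simp
      from bspec[OF adm[unfolded admissible_def] this]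
      have "x i \<in> set (patterns P) \<and> y i \<in> set (patterns Q) \<and>
          length (x i) + length (y i) < length P + length Q \<and> 2 \<le> length (x i) + length (y i)"
        by (simp add: case_prod_beta x_def y_def)
      then show "contained_in (x i) P" "contained_in (y i) Q" "length (x i) + length (y i) < length P + length Q"
        "2 \<le> length (x i) + length (y i)"
        using in_patterns_iff patterns_std by blast+
    qed
    have A: "distinct (A (x i) (y i))" "contained_in (A (x i) (y i)) s"
      "length (A (x i) (y i)) + length P + length Q = length s + length (x i) + length (y i)"
      "\<And>\<tau>. contained_in \<tau> (A (x i) (y i)) \<longleftrightarrow> (\<exists>(t, u)\<in>Tr \<tau>. contained_in t (x i) \<and> contained_in u (y i))"
      if "i < length X" for i
      using red xy(1,2)[OF that] by (simp_all add: reduction_def)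
    show ?case
    proof (rule mobius_eq_0_by_weights[where I = "{..<length X}" and A = "\<lambda>i. A (x i) (y i)" and w = "\<lambda>i. snd (X ! i)"])
      show "2 \<le> length s" using len PQ(1) by simp
      show "distinct (A (x i) (y i)) \<and> contained_in (A (x i) (y i)) s \<and> 2 \<le> length (A (x i) (y i)) \<and>
          length (A (x i) (y i)) < length s" if "i \<in> {..<length X}" for i
      proof -
        have "i < length X" using that by simp
        from A[OF this] xy[OF this] len show ?thesis by simp
      qed
    next
      fix \<tau> assume \<tau>: "is_perm \<tau>" "contained_in \<tau> s" "length \<tau> < length s" "mobius [1] \<tau> \<noteq> 0"
      define Fs' where "Fs' = [P, Q] # Fs"
      define T where "T = profile Fs' X ` Tr \<tau>"
      have d: "distinct \<tau>" using \<tau>(1) by (simp add: is_perm_def)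
      have novanish: "\<not> vanish Fs' a b" if ab: "a \<in> T" "b \<in> T" for a b
      proof
        assume "vanish Fs' a b"
        then obtain F where F: "F \<in> set Fs'" "\<And>R. R \<in> set F \<Longrightarrow> R \<in> set (snd a) \<or> R \<in> set (snd b)"
          by (auto simp: vanish_def list_ex_iff list_all_iff)
        have copy: "interval_copy R \<tau>" if R: "R \<in> set (snd c)" and c: "c \<in> T" for R c
        proof -
          obtain t u where tu: "c = profile Fs' X (t, u)" "(t, u) \<in> Tr \<tau>" using c by (auto simp: T_def)
          with R TrD[OF tu(2)] snd_profile[of R Fs' X t u \<tau>] show ?thesis by simp
        qed
        then have "\<forall>R\<in>set F. interval_copy R \<tau>" using F(2) ab by blast
        \<comment> \<open>The family \<open>[P, Q]\<close> is covered by the induction hypothesis,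
          as \<tau> is shorter than \<open>s\<close>; the others are covered by
          \<open>Fs\<close>.\<close>
        then have "mobius [1] (std \<tau>) = 0"
          using F(1) 1(1) \<tau>(3) d Fs unfolding Fs'_def annihilating_def by auto
        then show False using \<tau>(4) std_perm[OF \<tau>(1)] by simp
      qed
      have T: "T \<subseteq> set (profiles Fs' X P Q)"
      proof
        fix a assume a: "a \<in> T"
        then obtain t u where "a = profile Fs' X (t, u)" "(t, u) \<in> Tr \<tau>" by (auto simp: T_def)
        then show "a \<in> set (profiles Fs' X P Q)"
          using TrD novanish[OF a a] unfolding set_profiles by blast
      qed
      have "T \<noteq> {}" using Tr[OF \<tau>(2)] by (simp add: T_def)
      moreover have "fst a \<noteq> []" if "a \<in> T" for a
        using bal T that by (auto simp: balanced_profiles_def list_ex_iff Fs'_def split: if_splits)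
      ultimately have ne: "set [] \<union> (\<Union>a\<in>T. set (fst a)) \<noteq> {}" by auto
      have b: "balanced Fs' (map snd X) [] (profiles Fs' X P Q)"
        using bal by (auto simp: balanced_profiles_def Fs'_def split: if_splits)
      have V: "i \<in> (\<Union>a\<in>T. set (fst a)) \<longleftrightarrow> contained_in \<tau> (A (x i) (y i))" if i: "i < length X" for i
      proof -
        have "i \<in> set (fst (profile Fs' X (t, u))) \<longleftrightarrow> contained_in t (x i) \<and> contained_in u (y i)"
          if "(t, u) \<in> Tr \<tau>" for t u
          using fst_profile[of t P u Q Fs' X] TrD[OF that] i by (simp add: x_def y_def)
        then show ?thesis unfolding A(4)[OF i] T_def by fastforce
      qed
      have "(\<Sum>i | i \<in> {..<length X} \<and> contained_in \<tau> (A (x i) (y i)). snd (X ! i)) =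
          (\<Sum>i<length X. if contained_in \<tau> (A (x i) (y i)) then snd (X ! i) else 0)"
        by (rule sum.inter_filter) simp
      also have "\<dots> = (\<Sum>i<length (map snd X). if i \<in> set [] \<union> (\<Union>a\<in>T. set (fst a)) then map snd X ! i else 0)"
        using V by (intro sum.cong) auto
      also have "\<dots> = 1"
        by (rule balanced_weight[OF b T novanish ne])
      finally show "(\<Sum>i | i \<in> {..<length X} \<and> contained_in \<tau> (A (x i) (y i)). snd (X ! i)) = 1" .
    qed (use s(1) in simp_all)
  qed
qed


text \<open>By distinctness, an entry outside the block avoids the range \<open>{m..n}\<close> and
  so lies entirely below or above it.\<close>

lemma annihilator_if_annihilating:
  assumes "annihilating [\<phi>, []]"
  shows "annihilator \<phi>"
  unfolding annihilator_def
proof (intro allI impI)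
  fix \<pi> assume \<pi>: "is_perm \<pi>" "has_interval_copy \<pi> \<phi>"
  then obtain xs m n where xs: "sublist xs \<pi>" "set xs = {m..n}" "order_iso xs \<phi>"
    by (auto simp: has_interval_copy_def is_interval_of_def)
  then obtain L R where lr: "\<pi> = L @ xs @ R" by (auto simp: sublist_def)
  have d: "distinct \<pi>" using \<pi>(1) by (simp add: is_perm_def)
  have "separated xs (L @ R)"
    unfolding separated_def
  proof
    fix z assume "z \<in> set (L @ R)"
    then have "z \<notin> {m..n}" using d xs(2) by (auto simp: lr)
    then show "(\<forall>x\<in>set xs. z < x) \<or> (\<forall>x\<in>set xs. x < z)" unfolding xs(2) by auto
  qed
  then have "interval_copy \<phi> \<pi>" using interval_copyI[OF xs(3)] by (simp add: lr)
  then show "mobius [1] \<pi> = 0"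
    using assms[unfolded annihilating_def, rule_format, OF d] std_perm[OF \<pi>(1)] interval_copy_Nil by auto
qed

section \<open>Certificates\<close>

text \<open>The weights were found by solving the linear system behind \<^const>\<open>balanced\<close>.\<close>

lemma annihilating_12_21: "annihilating [[1,2], [2,1]]"
proof (rule annihilating_if_certified)
  \<comment> \<open>Inclusion-exclusion: a \<tau> below both shrunk permutations but not below the
    one for \<open>([1], [1])\<close> has copies of 12 and 21 itself.\<close>
  show "certified [1,2] [2,1]
     [(([1], [1]), -1), (([1], [2,1]), 1), (([1,2], [1]), 1)]
     []" by code_simp
qed simp

text \<open>Every pattern of 123 except 123 itself lies below 12, so one entry of weight 1
  suffices.\<close>

lemma annihilating_123: "annihilating [[1,2,3], []]"
proof (rule annihilating_if_certified)
  show "certified [1,2,3] []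
     [(([1,2], []), 1)]
     []" by code_simp
qed simp

lemma annihilating_321: "annihilating [[3,2,1], []]"
proof (rule annihilating_if_certified)
  show "certified [3,2,1] []
     [(([2,1], []), 1)]
     []" by code_simp
qed simp

lemma annihilating_132_3241: "annihilating [[1,3,2], [3,2,4,1]]"
proof (rule annihilating_if_certified)
  show "certified [1,3,2] [3,2,4,1]
     [(([1], [1,2]), 1), (([1], [2,3,1]), -1), (([1,2], [1,2]), -1), (([1,2], [2,3,1]), 1),
      (([2,1], [2,1,3]), -1), (([2,1], [3,2,4,1]), 1), (([1,3,2], [2,1,3]), 1)]
     [[[1,2], [2,1]], [[3,2,1], []]]" by code_simp
qed (use annihilating_12_21 annihilating_321 in simp)

text \<open>Pair and weights are the images of the preceding ones under reverse-complement followed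
  by inversion.\<close>

lemma annihilating_213_2431: "annihilating [[2,1,3], [2,4,3,1]]"
proof (rule annihilating_if_certified)
  show "certified [2,1,3] [2,4,3,1]
     [(([1], [1,2]), 1), (([1], [2,3,1]), -1), (([1,2], [1,2]), -1), (([1,2], [2,3,1]), 1),
      (([2,1], [1,3,2]), -1), (([2,1], [2,4,3,1]), 1), (([2,1,3], [1,3,2]), 1)]
     [[[1,2], [2,1]], [[3,2,1], []]]" by code_simp
qed (use annihilating_12_21 annihilating_321 in simp)

text \<open>Pair and weights are the complements of those for 132 and 3241.\<close>

lemma annihilating_312_2314: "annihilating [[3,1,2], [2,3,1,4]]"
proof (rule annihilating_if_certified)
  show "certified [3,1,2] [2,3,1,4]
     [(([1], [2,1]), 1), (([1], [2,1,3]), -1), (([2,1], [2,1]), -1), (([2,1], [2,1,3]), 1),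
      (([1,2], [2,3,1]), -1), (([1,2], [2,3,1,4]), 1), (([3,1,2], [2,3,1]), 1)]
     [[[1,2], [2,1]], [[1,2,3], []]]" by code_simp
qed (use annihilating_12_21 annihilating_123 in simp)

text \<open>Inclusion-exclusion with both patterns shrunk to 213. The pair (132, 3241) lies below no
  entry and is disposed of by \<open>annihilating_132_3241\<close>.\<close>

lemma annihilating_2143_3241: "annihilating [[2,1,4,3], [3,2,4,1]]"
proof (rule annihilating_if_certified)
  show "certified [2,1,4,3] [3,2,4,1]
     [(([2,1,3], [2,1,3]), -1), (([2,1,3], [3,2,4,1]), 1), (([2,1,4,3], [2,1,3]), 1)]
     [[[1,2], [2,1]], [[3,2,1], []], [[1,3,2], [3,2,4,1]]]" by code_simp
qed (use annihilating_12_21 annihilating_321 annihilating_132_3241 in simp)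

lemma annihilating_2143_2431: "annihilating [[2,1,4,3], [2,4,3,1]]"
proof (rule annihilating_if_certified)
  show "certified [2,1,4,3] [2,4,3,1]
     [(([1,3,2], [1,3,2]), -1), (([1,3,2], [2,4,3,1]), 1), (([2,1,4,3], [1,3,2]), 1)]
     [[[1,2], [2,1]], [[3,2,1], []], [[2,1,3], [2,4,3,1]]]" by code_simp
qed (use annihilating_12_21 annihilating_321 annihilating_213_2431 in simp)

text \<open>The proper patterns not below 1423 are 1234, with a copy of 123, and 1243, with copies
  of 12 and 21.\<close>

lemma annihilating_12534: "annihilating [[1,2,5,3,4], []]"
proof (rule annihilating_if_certified)
  show "certified [1,2,5,3,4] []
     [(([1,4,2,3], []), 1)]
     [[[1,2], [2,1]], [[1,2,3], []]]" by code_simp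
qed (use annihilating_12_21 annihilating_123 in simp)

lemma annihilating_23145: "annihilating [[2,3,1,4,5], []]"
proof (rule annihilating_if_certified)
  show "certified [2,3,1,4,5] []
     [(([2,3,1,4], []), 1)]
     [[[1,2], [2,1]], [[1,2,3], []]]" by code_simp
qed (use annihilating_12_21 annihilating_123 in simp)

lemma annihilating_2314_25134: "annihilating [[2,3,1,4], [2,5,1,3,4]]"
proof (rule annihilating_if_certified)
  show "certified [2,3,1,4] [2,5,1,3,4]
     [(([2,3,1], [2,4,1,3]), -1), (([2,3,1], [2,5,1,3,4]), 1), (([2,3,1,4], [2,4,1,3]), 1)]
     [[[1,2], [2,1]], [[1,2,3], []], [[3,1,2], [2,3,1,4]]]" by code_simp
qed (use annihilating_12_21 annihilating_123 annihilating_312_2314 in simp)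

text \<open>Pair and weights are the reverse-complements of the preceding ones.\<close>

lemma annihilating_1423_23514: "annihilating [[1,4,2,3], [2,3,5,1,4]]"
proof (rule annihilating_if_certified)
  show "certified [1,4,2,3] [2,3,5,1,4]
     [(([3,1,2], [2,4,1,3]), -1), (([3,1,2], [2,3,5,1,4]), 1), (([1,4,2,3], [2,4,1,3]), 1)]
     [[[1,2], [2,1]], [[1,2,3], []], [[3,1,2], [2,3,1,4]]]" by code_simp
qed (use annihilating_12_21 annihilating_123 annihilating_312_2314 in simp)

lemma annihilating_23514_25134: "annihilating [[2,3,5,1,4], [2,5,1,3,4]]"
proof (rule annihilating_if_certified)
  show "certified [2,3,5,1,4] [2,5,1,3,4]
     [(([2,4,1,3], [2,4,1,3]), -1), (([2,4,1,3], [2,5,1,3,4]), 1), (([2,3,5,1,4], [2,4,1,3]), 1)]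
     [[[1,2], [2,1]], [[1,2,3], []], [[3,1,2], [2,3,1,4]], [[2,3,1,4], [2,5,1,3,4]],
      [[1,4,2,3], [2,3,5,1,4]]]" by code_simp
qed (use annihilating_12_21 annihilating_123 annihilating_312_2314 annihilating_2314_25134 annihilating_1423_23514 in simp)

text \<open>The one-point deletions are 14352, 21435, 21453 (copies of 12 and 21) and 21543 (a copy
  of 321). Meeting both of the first two forces copies of 3241 and 2143; 1324 corrects the double
  count.\<close>

lemma annihilating_215463: "annihilating [[2,1,5,4,6,3], []]"
proof (rule annihilating_if_certified)
  show "certified [2,1,5,4,6,3] []
     [(([1,3,2,4], []), -1), (([1,4,3,5,2], []), 1), (([2,1,4,3,5], []), 1)]
     [[[1,2], [2,1]], [[3,2,1], []], [[2,1,4,3], [3,2,4,1]]]" by code_simp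
qed (use annihilating_12_21 annihilating_321 annihilating_2143_3241 in simp)

text \<open>Deleting 1 or 6 leaves 12534 or 23145, already annihilating. The other deletions give
  23514 and 25134, which exclude each other by \<open>annihilating_23514_25134\<close>.\<close>

lemma annihilating_236145: "annihilating [[2,3,6,1,4,5], []]"
proof (rule annihilating_if_certified)
  show "certified [2,3,6,1,4,5] []
     [(([2,4,1,3], []), -1), (([2,3,5,1,4], []), 1), (([2,5,1,3,4], []), 1)]
     [[[1,2], [2,1]], [[1,2,3], []], [[3,1,2], [2,3,1,4]], [[1,2,5,3,4], []], [[2,3,1,4,5], []],
      [[2,3,1,4], [2,5,1,3,4]], [[1,4,2,3], [2,3,5,1,4]], [[2,3,5,1,4], [2,5,1,3,4]]]" by code_simp
qed (use annihilating_12_21 annihilating_123 annihilating_312_2314 annihilating_12534 annihilating_23145 annihilating_2314_25134 annihilating_1423_23514 annihilating_23514_25134 in simp)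

text \<open>The deletions 21543 and 21453 vanish as for 215463. Of the other two, 13542 has a copy
  of 2431 and 21354 one of 213, so they exclude each other.\<close>

lemma annihilating_214653: "annihilating [[2,1,4,6,5,3], []]"
proof (rule annihilating_if_certified)
  show "certified [2,1,4,6,5,3] []
     [(([1,3,2], []), -1), (([1,3,5,4,2], []), 1), (([2,1,3,5,4], []), 1)]
     [[[1,2], [2,1]], [[1,2,3], []], [[3,2,1], []], [[2,1,3], [2,4,3,1]], [[2,1,4,3], [2,4,3,1]]]" by code_simp
qed (use annihilating_12_21 annihilating_123 annihilating_321 annihilating_213_2431 annihilating_2143_2431 in simp)

theorem theorem6p5:
  shows "\<forall>\<phi> \<in> {[2,1,5,4,6,3], [2,3,6,1,4,5], [2,1,4,6,5,3]}. annihilator \<phi>"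
  using annihilator_if_annihilating[OF annihilating_215463]
    annihilator_if_annihilating[OF annihilating_236145]
    annihilator_if_annihilating[OF annihilating_214653]
  by simp

end
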